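(* Let $G$ be a topological group and let $\alpha$ be an affine isometric action of $G$ on a (real or complex) Hilbert space $\mathcal H$, with linear part $\pi$. The following properties are equivalent: (i) $\alpha$ is irreducible. (ii) The commutant of $\alpha$ is the set of translations along $\mathcal H^{\pi(G)}$, i.e. the set of maps $v\mapsto v+t$ with $t\in\mathcal H^{\pi(G)}$. (iii) The commutant of $\alpha$ consists of translations.
   Context: An affine isometric action of $G$ on $\mathcal H$ has the form $\alpha(g)v=\pi(g)v+b(g)$ with $\pi$ a continuous unitary (orthogonal, in the real case) representation, called the linear part, and $b:G\to\mathcal H$ a continuous 1-cocycle ($b(gh)=b(g)+\pi(g)b(h)$). It is irreducible if $\mathcal H$ has no non-empty, closed, proper $\alpha(G)$-invariant affine subspace. The commutant of $\alpha$ is the set of continuous affine maps $A:\mathcal H\to\mathcal H$ such that $A\circ\alpha(g)=\alpha(g)\circ A$ for every $g\in G$; a continuous affine map is one of the form $Av=Tv+t$ with $T$ a bounded linear operator and $t\in\mathcal H$. $\mathcal H^{\pi(G)}$ is the space of $\pi(G)$-fixed vectors. *)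

theory Defs
  imports "HOL-Analysis.Analysis"
begin

text \<open>
  The scalar fields: exactly the reals (\<open>imunit = 0\<close>) and the complex numbers
  (\<open>imunit * imunit = - 1\<close>), each with its conjugation. The norm need not be described:
  a multiplicative norm extending the one on the reals is the usual absolute value.
\<close>

class real_or_complex = real_normed_field +
  fixes conjugate :: "'a \<Rightarrow> 'a"
    and imunit :: 'a
  assumes imunit_cases: "imunit = 0 \<or> imunit * imunit = - 1"
    and scalar_decomp: "\<exists>a b. z = a *\<^sub>R 1 + b *\<^sub>R imunit"
    and conjugate_decomp:
      "conjugate (a *\<^sub>R 1 + b *\<^sub>R imunit) = a *\<^sub>R 1 - b *\<^sub>R imunit"

instantiation real :: real_or_complex
begin
definition "conjugate = (\<lambda>x::real. x)"
definition "imunit = (0::real)"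
instance by standard (auto simp: conjugate_real_def imunit_real_def)
end

instantiation complex :: real_or_complex
begin
definition "conjugate = cnj"
definition "imunit = \<i>"
instance
proof
  fix z :: complex
  show "\<exists>a b. z = a *\<^sub>R 1 + b *\<^sub>R imunit"
    by (intro exI[of _ "Re z"] exI[of _ "Im z"]) (simp add: imunit_complex_def complex_eq_iff)
qed (auto simp: conjugate_complex_def imunit_complex_def)
end

text \<open>
  The inner product is linear in its first argument. Completeness is part of the class
  \<open>banach\<close>; the last two axioms say that the real normed structure of that class
  is the one underlying the inner product space, and give positive definiteness.
\<close>

locale hilbert_space = vector_space smul
  for smul :: "'k::real_or_complex \<Rightarrow> 'h::banach \<Rightarrow> 'h" +
  fixes ip :: "'h \<Rightarrow> 'h \<Rightarrow> 'k"
  assumes ip_add_left: "ip (x + y) z = ip x z + ip y z"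
    and ip_smul_left: "ip (smul c x) y = c * ip x y"
    and ip_conjugate: "ip y x = conjugate (ip x y)"
    and smul_of_real: "smul (of_real r) x = r *\<^sub>R x"
    and ip_self: "ip x x = of_real ((norm x)\<^sup>2)"

lemma hilbert_space_real:
  "hilbert_space (scaleR :: real \<Rightarrow> 'h \<Rightarrow> 'h) (inner :: 'h::{real_inner,banach} \<Rightarrow> _)"
  by unfold_locales
    (auto simp: inner_add_left inner_commute conjugate_real_def power2_norm_eq_inner algebra_simps)

lemma hilbert_space_complex:
  "hilbert_space ((*) :: complex \<Rightarrow> complex \<Rightarrow> complex) (\<lambda>x y. x * cnj y)"
  by unfold_locales
    (auto simp: conjugate_complex_def complex_norm_square[symmetric] scaleR_conv_of_real algebra_simps)

definition unitary_operator ::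
  "('k::real_or_complex \<Rightarrow> 'h::banach \<Rightarrow> 'h) \<Rightarrow> ('h \<Rightarrow> 'h \<Rightarrow> 'k) \<Rightarrow> ('h \<Rightarrow> 'h) \<Rightarrow> bool"
  where "unitary_operator smul ip U \<longleftrightarrow>
    Vector_Spaces.linear smul smul U \<and> bij U \<and> (\<forall>x y. ip (U x) (U y) = ip x y)"

text \<open>
  The class \<open>topological_group_add\<close> consists of arbitrary, not necessarily
  commutative, topological groups; the group operation is written additively.
  A unitary representation is continuous in the strong operator topology.
\<close>

locale unitary_representation = hilbert_space smul ip
  for smul :: "'k::real_or_complex \<Rightarrow> 'h::banach \<Rightarrow> 'h" and ip :: "'h \<Rightarrow> 'h \<Rightarrow> 'k" +
  fixes \<pi> :: "'g::topological_group_add \<Rightarrow> 'h \<Rightarrow> 'h"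
  assumes unitary: "unitary_operator smul ip (\<pi> g)"
    and rep_zero: "\<pi> 0 = id"
    and rep_add: "\<pi> (g + h) = \<pi> g \<circ> \<pi> h"
    and rep_continuous: "continuous_on UNIV (\<lambda>g. \<pi> g v)"

locale affine_isometric_action = unitary_representation smul ip \<pi>
  for smul :: "'k::real_or_complex \<Rightarrow> 'h::banach \<Rightarrow> 'h" and ip :: "'h \<Rightarrow> 'h \<Rightarrow> 'k"
    and \<pi> :: "'g::topological_group_add \<Rightarrow> 'h \<Rightarrow> 'h" +
  fixes b :: "'g \<Rightarrow> 'h"
    and \<alpha> :: "'g \<Rightarrow> 'h \<Rightarrow> 'h"
  assumes cocycle: "b (g + h) = b g + \<pi> g (b h)"
    and cocycle_continuous: "continuous_on UNIV b"
    and action_eq: "\<alpha> g v = \<pi> g v + b g"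

text \<open>As for \<^const>\<open>affine\<close> in the library, the empty set is included.\<close>

definition affine_subspace :: "('k::real_or_complex \<Rightarrow> 'h::banach \<Rightarrow> 'h) \<Rightarrow> 'h set \<Rightarrow> bool"
  where "affine_subspace smul S \<longleftrightarrow>
    (\<forall>x\<in>S. \<forall>y\<in>S. \<forall>u v. u + v = 1 \<longrightarrow> smul u x + smul v y \<in> S)"

definition irreducible_action ::
  "('k::real_or_complex \<Rightarrow> 'h::banach \<Rightarrow> 'h) \<Rightarrow> ('g \<Rightarrow> 'h \<Rightarrow> 'h) \<Rightarrow> bool"
  where "irreducible_action smul \<alpha> \<longleftrightarrow>
    \<not> (\<exists>S. affine_subspace smul S \<and> S \<noteq> {} \<and> closed S \<and> S \<noteq> UNIV \<and> (\<forall>g. \<alpha> g ` S \<subseteq> S))"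

definition continuous_affine_map ::
  "('k::real_or_complex \<Rightarrow> 'h::banach \<Rightarrow> 'h) \<Rightarrow> ('h \<Rightarrow> 'h) \<Rightarrow> bool"
  where "continuous_affine_map smul A \<longleftrightarrow>
    (\<exists>T t. Vector_Spaces.linear smul smul T \<and> bounded_linear T \<and> A = (\<lambda>v. T v + t))"

definition commutant ::
  "('k::real_or_complex \<Rightarrow> 'h::banach \<Rightarrow> 'h) \<Rightarrow> ('g \<Rightarrow> 'h \<Rightarrow> 'h) \<Rightarrow> ('h \<Rightarrow> 'h) set"
  where "commutant smul \<alpha> =
    {A. continuous_affine_map smul A \<and> (\<forall>g. A \<circ> \<alpha> g = \<alpha> g \<circ> A)}"

definition fixed_vectors :: "('g \<Rightarrow> 'h \<Rightarrow> 'h) \<Rightarrow> 'h set"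
  where "fixed_vectors \<pi> = {v. \<forall>g. \<pi> g v = v}"

definition translation :: "'h::plus \<Rightarrow> 'h \<Rightarrow> 'h"
  where "translation t = (\<lambda>v. v + t)"

end

theory Submission
  imports Defs
begin

text \<open>
  Let \<open>A v = T v + t\<close> commute with the action and put \<open>N = T - 1\<close>, \<open>M = N\<^sup>* N\<close>, \<open>s = N\<^sup>* t\<close>;
  then \<open>v \<mapsto> M v + s\<close> intertwines \<open>\<alpha>\<close> and \<open>\<pi>\<close>. If \<open>N \<noteq> 0\<close>, a spectral cut-off of \<open>M\<close> gives an
  invariant affine subspace: with \<open>C = M - \<epsilon>\<close> and \<open>P = \<bar>C\<bar> + C\<close>, the set
  \<open>{v. P (M v + s) = 0}\<close> is proper when \<open>\<epsilon>\<close> is small, and it is non-empty because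
  \<open>P M = P (\<epsilon> + \<bar>C\<bar>)\<close> and \<open>\<epsilon> + \<bar>C\<bar>\<close> is coercive. Conversely, the orthogonal projection onto a
  closed invariant affine subspace commutes with the action. Everything takes place in the
  underlying real Hilbert space, where scalar multiplications are treated on a par with the
  operators \<open>\<pi>(g)\<close>: both families are closed under adjoints.
\<close>

section \<open>Real Hilbert spaces: Riesz representation and adjoints\<close>

text \<open>The inner product is a parameter because the type of vectors carries only the class
  \<open>banach\<close>. It is instantiated below with \<open>real_form\<close>.\<close>

locale real_hilbert_form =
  fixes B :: "'h::banach \<Rightarrow> 'h \<Rightarrow> real"
  assumes form_add_left: "B (x + y) z = B x z + B y z"
    and form_scaleR_left: "B (r *\<^sub>R x) y = r * B x y"
    and form_commute: "B x y = B y x"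
    and form_self: "B x x = (norm x)\<^sup>2"
begin

lemma form_add_right: "B x (y + z) = B x y + B x z"
  by (metis form_add_left form_commute)

lemma form_scaleR_right: "B x (r *\<^sub>R y) = r * B x y"
  by (metis form_scaleR_left form_commute)

lemma norm_add_square: "(norm (x + y))\<^sup>2 = (norm x)\<^sup>2 + 2 * B x y + (norm y)\<^sup>2"
  using form_commute[of x y] by (simp add: form_self[symmetric] form_add_left form_add_right)

lemma norm_diff_scaleR_square:
  "(norm (x - r *\<^sub>R y))\<^sup>2 = (norm x)\<^sup>2 - 2 * r * B x y + r\<^sup>2 * (norm y)\<^sup>2"
  using norm_add_square[of x "(- r) *\<^sub>R y"]
  by (simp only: form_scaleR_right norm_scaleR) (simp add: power_mult_distrib)

lemma form_le_norm: "B x y \<le> norm x * norm y"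
proof -
  have "(norm (x + y))\<^sup>2 \<le> (norm x + norm y)\<^sup>2"
    by (simp add: norm_triangle_ineq power_mono)
  then show ?thesis by (simp add: norm_add_square power2_sum)
qed

lemma abs_form_le_norm: "\<bar>B x y\<bar> \<le> norm x * norm y"
  using form_le_norm[of x y] form_le_norm[of "- x" y] form_scaleR_left[of "- 1" x y] by auto

sublocale bounded_bilinear B
  by unfold_locales
    (auto simp: form_add_left form_add_right form_scaleR_left form_scaleR_right
      intro!: exI[of _ 1] abs_form_le_norm)

text \<open>The difference \<open>x - x'\<close> lies in \<open>K\<close>, so it may be paired with
  itself.\<close>

lemma form_eqI:
  assumes "subspace K" "x \<in> K" "x' \<in> K" "\<And>y. y \<in> K \<Longrightarrow> B x y = B x' y"
  shows "x = x'"
proof -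
  have "B (x - x') (x - x') = 0"
    using assms subspace_diff[OF assms(1-3)] by (simp add: diff_left)
  then show ?thesis by (simp add: form_self)
qed

text \<open>Direct method: a minimising sequence of the functional \<open>J\<close> on
  \<open>K\<close> converges, and the first variation of \<open>J\<close> vanishes at the
  limit.\<close>

lemma riesz_subspace:
  assumes K: "subspace K" "closed K" and \<phi>: "bounded_linear \<phi>"
  shows "\<exists>x\<in>K. \<forall>y\<in>K. B x y = \<phi> y"
proof -
  interpret \<phi>: bounded_linear \<phi> by (rule \<phi>)
  define J where "J x = (norm x)\<^sup>2 - 2 * \<phi> x" for x
  obtain c where c: "\<And>x. norm (\<phi> x) \<le> norm x * c"
    using \<phi>.bounded by blast
  \<comment> \<open>Complete the square, using
    \<open>norm (\<phi> x) \<le> norm x * c\<close>.\<close>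
  have below: "- c\<^sup>2 \<le> J x" for x
  proof -
    have "0 \<le> (norm x - c)\<^sup>2" by simp
    then show ?thesis
      using c[of x] unfolding J_def power2_diff real_norm_def by (simp add: abs_le_iff)
  qed
  define m where "m = Inf (J ` K)"
  have bdd: "bdd_below (J ` K)" using below by (intro bdd_belowI2)
  have ne: "J ` K \<noteq> {}" using subspace_0[OF K(1)] by blast
  have m_le: "m \<le> J x" if "x \<in> K" for x
    unfolding m_def using that bdd by (simp add: cInf_lower)
  have "\<exists>x\<in>K. J x < m + 1 / real (Suc n)" for n
  proof -
    have "Inf (J ` K) < m + 1 / real (Suc n)" unfolding m_def by simp
    from cInf_lessD[OF ne this] show ?thesis by blast
  qed
  then obtain f where f: "\<And>n. f n \<in> K" "\<And>n. J (f n) < m + 1 / real (Suc n)"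
    by metis
  \<comment> \<open>Parallelogram law; the midpoint lies in \<open>K\<close>, so its value is at
    least \<open>m\<close>.\<close>
  have para: "(norm (x - y))\<^sup>2 \<le> 2 * (J x - m) + 2 * (J y - m)" if "x \<in> K" "y \<in> K" for x y
  proof -
    have "(norm (x - y))\<^sup>2 = 2 * J x + 2 * J y - 4 * J ((1/2) *\<^sub>R (x + y))"
      using form_commute[of x y]
      by (simp add: J_def form_self[symmetric] add_left add_right diff_left diff_right
          scaleR_left scaleR_right \<phi>.add \<phi>.scaleR algebra_simps)
    moreover have "m \<le> J ((1/2) *\<^sub>R (x + y))"
      using that K(1) by (intro m_le) (simp add: subspace_add subspace_scale)
    ultimately show ?thesis by simp
  qed
  have "Cauchy f"
  proof (rule metric_CauchyI)
    fix e :: real assume e: "0 < e"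
    obtain n0 :: nat where n0: "4 / e\<^sup>2 < real n0" using reals_Archimedean2 by blast
    have small: "J (f n) - m < e\<^sup>2 / 4" if "n \<ge> n0" for n
    proof -
      have "4 / e\<^sup>2 < real (Suc n)" using n0 that by linarith
      then have "1 / real (Suc n) < e\<^sup>2 / 4" using e by (simp add: field_simps)
      then show ?thesis using f(2)[of n] by linarith
    qed
    have "dist (f i) (f j) < e" if "i \<ge> n0" "j \<ge> n0" for i j
    proof -
      have "(norm (f i - f j))\<^sup>2 < e\<^sup>2"
        using para[OF f(1)[of i] f(1)[of j]] small[OF that(1)] small[OF that(2)] by argo
      then show ?thesis using e by (simp add: dist_norm power2_less_imp_less)
    qed
    then show "\<exists>n0. \<forall>i\<ge>n0. \<forall>j\<ge>n0. dist (f i) (f j) < e" by blast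
  qed
  then obtain x where lim: "f \<longlonglongrightarrow> x" by (auto simp: Cauchy_convergent_iff convergent_def)
  have xK: "x \<in> K" using closed_sequentially[OF K(2)] f(1) lim by blast
  have "(\<lambda>n. J (f n)) \<longlonglongrightarrow> J x"
    unfolding J_def by (intro tendsto_intros \<phi>.tendsto lim)
  moreover have "(\<lambda>n. m + 1 / real (Suc n)) \<longlonglongrightarrow> m + 0"
    by (intro tendsto_intros LIMSEQ_Suc lim_1_over_n)
  ultimately have "J x \<le> m"
    using LIMSEQ_le[of "\<lambda>n. J (f n)" "J x" "\<lambda>n. m + 1 / real (Suc n)" "m + 0"] f(2)
    by (auto intro: less_imp_le)
  then have min: "J x \<le> J y" if "y \<in> K" for y using m_le[OF that] by linarith
  have "B x y = \<phi> y" if y: "y \<in> K" for y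
  proof (cases "y = 0")
    case True then show ?thesis by (simp add: zero_right \<phi>.zero)
  next
    case False
    define d where "d = B x y - \<phi> y"
    \<comment> \<open>The minimiser of the quadratic function \<open>J (x + r *\<^sub>R y)\<close>
      of \<open>r\<close>; it would lower \<open>J x\<close> by
      \<open>d\<^sup>2 / (norm y)\<^sup>2\<close>.\<close>
    define r where "r = - d / (norm y)\<^sup>2"
    have "J (x + r *\<^sub>R y) = J x + 2 * r * d + r\<^sup>2 * (norm y)\<^sup>2"
      by (simp add: J_def norm_add_square scaleR_right \<phi>.add \<phi>.scaleR d_def power_mult_distrib
          algebra_simps)
    also have "\<dots> = J x - d\<^sup>2 / (norm y)\<^sup>2"
      using False by (simp add: r_def field_simps power2_eq_square)
    finally have "d\<^sup>2 / (norm y)\<^sup>2 \<le> 0"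
      using min[of "x + r *\<^sub>R y"] xK y K(1) by (simp add: subspace_add subspace_scale)
    then have "d = 0" using False by (simp add: divide_le_0_iff)
    then show ?thesis by (simp add: d_def)
  qed
  then show ?thesis using xK by blast
qed

text \<open>The case \<open>T = id\<close> is the orthogonal projection onto \<open>K\<close>, the case \<open>K = UNIV\<close> the adjoint of \<open>T\<close>.\<close>

lemma compressed_adjoint:
  assumes K: "subspace K" "closed K" and T: "bounded_linear T"
  obtains p where "bounded_linear p" "\<And>v. p v \<in> K" "\<And>v y. y \<in> K \<Longrightarrow> B (p v) y = B v (T y)"
proof -
  interpret T: bounded_linear T by (rule T)
  have "\<exists>x\<in>K. \<forall>y\<in>K. B x y = B v (T y)" for v
    using bounded_linear_compose[OF bounded_linear_right T]
    by (intro riesz_subspace K)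
  then obtain p where p: "\<And>v. p v \<in> K" "\<And>v y. y \<in> K \<Longrightarrow> B (p v) y = B v (T y)"
    by metis
  obtain c where c: "c > 0" "\<And>x. norm (T x) \<le> norm x * c" using T.pos_bounded by blast
  have "bounded_linear p"
  proof (rule bounded_linear_intro)
    show "p (x + y) = p x + p y" for x y
      by (rule form_eqI[OF K(1)]) (use p K(1) in \<open>auto simp: subspace_add add_left\<close>)
    show "p (r *\<^sub>R x) = r *\<^sub>R p x" for r x
      by (rule form_eqI[OF K(1)]) (use p K(1) in \<open>auto simp: subspace_scale scaleR_left\<close>)
    show "norm (p x) \<le> norm x * c" for x
    proof (cases "norm (p x) = 0")
      case False
      \<comment> \<open>The defining identity is tested at \<open>y = p x\<close>, which lies in
        \<open>K\<close>.\<close>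
      have "(norm (p x))\<^sup>2 = B x (T (p x))" by (metis p form_self)
      also have "\<dots> \<le> norm x * norm (T (p x))" by (rule form_le_norm)
      also have "\<dots> \<le> norm x * (norm (p x) * c)" by (intro mult_left_mono c) simp
      finally show ?thesis using False by (simp add: power2_eq_square)
    qed (use c in simp)
  qed
  with p that show thesis by blast
qed

text \<open>Against \<open>y\<close> in \<open>K\<close>, both sides equal
  \<open>B v (T (D' y))\<close>: move \<open>D\<close> across the form, exchange \<open>D'\<close>
  with \<open>T\<close>, and use that \<open>D'\<close> preserves \<open>K\<close>. It is applied to
  group operators and to scalar multiplications.\<close>

lemma compressed_adjoint_commute:
  assumes K: "subspace K" and p: "\<And>v. p v \<in> K" "\<And>v y. y \<in> K \<Longrightarrow> B (p v) y = B v (T y)"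
    and adj: "\<And>x y. B (D x) y = B x (D' y)"
    and inv: "\<And>x. x \<in> K \<Longrightarrow> D x \<in> K" "\<And>x. x \<in> K \<Longrightarrow> D' x \<in> K"
    and comm: "\<And>x. x \<in> K \<Longrightarrow> T (D' x) = D' (T x)"
  shows "p (D v) = D (p v)"
  by (rule form_eqI[OF K]) (simp_all add: p adj inv comm)

end

section \<open>Square roots by iteration\<close>

text \<open>The square root of \<open>1 - X\<close> is \<open>1 - Y\<close>. The iteration defining \<open>Y\<close> is dominated in norm by
  the same iteration for the number 1, which is increasing and bounded.\<close>

lemma half_square_iteration:
  fixes X :: "'h::banach \<Rightarrow>\<^sub>L 'h"
  assumes X: "norm X \<le> 1"
  obtains Y where "norm Y \<le> 1" "2 *\<^sub>R Y = X + (Y o\<^sub>L Y)"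
    "\<And>D. D o\<^sub>L X = X o\<^sub>L D \<Longrightarrow> D o\<^sub>L Y = Y o\<^sub>L D"
proof -
  have compose_assoc: "(S o\<^sub>L T) o\<^sub>L U = S o\<^sub>L (T o\<^sub>L U)" for S T U :: "'h \<Rightarrow>\<^sub>L 'h"
    by (rule blinfun_eqI) simp
  interpret comp: bounded_bilinear "(o\<^sub>L) :: ('h \<Rightarrow>\<^sub>L 'h) \<Rightarrow> ('h \<Rightarrow>\<^sub>L 'h) \<Rightarrow> ('h \<Rightarrow>\<^sub>L 'h)"
    by (rule bounded_bilinear_blinfun_compose)
  define F where "F = (\<lambda>Z. (1/2) *\<^sub>R (X + (Z o\<^sub>L Z)))"
  define Y where "Y n = (F ^^ n) 0" for n
  define y where "y n = ((\<lambda>z::real. (1 + z\<^sup>2) / 2) ^^ n) 0" for n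
  have Y: "Y 0 = 0" "\<And>n. Y (Suc n) = (1/2) *\<^sub>R (X + (Y n o\<^sub>L Y n))"
    and y: "y 0 = 0" "\<And>n. y (Suc n) = (1 + (y n)\<^sup>2) / 2"
    by (simp_all add: Y_def y_def F_def)
  \<comment> \<open>Each iterate is a polynomial in \<open>X\<close>.\<close>
  have comm: "D o\<^sub>L Y n = Y n o\<^sub>L D" if "D o\<^sub>L X = X o\<^sub>L D" for D n
  proof (induction n)
    case (Suc n)
    have "D o\<^sub>L (Y n o\<^sub>L Y n) = (Y n o\<^sub>L Y n) o\<^sub>L D"
      by (metis Suc.IH compose_assoc)
    then show ?case
      by (simp add: Y comp.add_left comp.add_right comp.scaleR_left comp.scaleR_right that)
  qed (simp add: Y comp.zero_left comp.zero_right)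
  have y1: "0 \<le> y n \<and> y n \<le> 1" for n
  proof (induction n)
    case (Suc n) then show ?case by (simp add: y abs_square_le_1)
  qed (simp add: y)
  have nY: "norm (Y n) \<le> y n" for n
  proof (induction n)
    case (Suc n)
    have "norm (Y n o\<^sub>L Y n) \<le> norm (Y n) * norm (Y n)" by (rule norm_blinfun_compose)
    also have "\<dots> \<le> (y n)\<^sup>2" unfolding power2_eq_square
      by (intro mult_mono Suc) (use y1 in auto)
    finally show ?case
      using X norm_triangle_ineq[of X "Y n o\<^sub>L Y n"] by (simp add: Y y)
  qed (simp add: Y y)
  have diff: "norm (Y (Suc n) - Y n) \<le> y (Suc n) - y n" for n
  proof (induction n)
    case 0 then show ?case using nY[of 1] by (simp add: Y y)
  next
    case (Suc n)
    \<comment> \<open>Two uses of \<open>comm\<close>: iterates commute with \<open>X\<close>, hence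
      with one another. The difference of squares then factors.\<close>
    have "Y (Suc n) o\<^sub>L Y n = Y n o\<^sub>L Y (Suc n)"
      by (metis comm)
    then have "Y (Suc (Suc n)) - Y (Suc n)
        = (1/2) *\<^sub>R ((Y (Suc n) - Y n) o\<^sub>L (Y (Suc n) + Y n))"
      by (simp add: Y(2)[of "Suc n"] Y(2)[of n] del: Y(1))
        (simp add: Y(2)[of n, symmetric] comp.add_left comp.add_right comp.diff_left
          comp.diff_right algebra_simps)
    then have "norm (Y (Suc (Suc n)) - Y (Suc n))
        \<le> (1/2) * (norm (Y (Suc n) - Y n) * norm (Y (Suc n) + Y n))"
      using norm_blinfun_compose[of "Y (Suc n) - Y n" "Y (Suc n) + Y n"] by simp
    also have "\<dots> \<le> (1/2) * ((y (Suc n) - y n) * (y (Suc n) + y n))"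
      using nY[of n] nY[of "Suc n"] norm_triangle_ineq[of "Y (Suc n)" "Y n"] Suc
        norm_ge_zero[of "Y (Suc n) - Y n"]
      by (intro mult_left_mono mult_mono) (linarith | simp)+
    also have "\<dots> = y (Suc (Suc n)) - y (Suc n)"
      by (simp add: y(2)[of "Suc n"] y(2)[of n] power2_eq_square field_simps)
    finally show ?case .
  qed
  \<comment> \<open>The scalar sums telescope and stay below 1; they dominate the increments of
    \<open>Y\<close> in norm, so \<open>Y\<close> converges.\<close>
  have "summable (\<lambda>n. y (Suc n) - y n)"
  proof (rule summableI_nonneg_bounded)
    show "0 \<le> y (Suc n) - y n" for n using diff[of n] norm_ge_zero order_trans by blast
    show "(\<Sum>i<n. y (Suc i) - y i) \<le> 1" for n
      unfolding sum_lessThan_telescope using y1[of n] y by simp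
  qed
  then have "summable (\<lambda>n. Y (Suc n) - Y n)"
    by (rule summable_comparison_test'[where N = 0]) (rule diff)
  then have "(\<lambda>n. \<Sum>i<n. Y (Suc i) - Y i) \<longlonglongrightarrow> (\<Sum>n. Y (Suc n) - Y n)"
    by (rule summable_LIMSEQ)
  then obtain L where L: "Y \<longlonglongrightarrow> L"
    unfolding sum_lessThan_telescope by (auto simp: Y)
  show thesis
  proof
    have "norm (Y n) \<le> 1" for n using nY[of n] y1[of n] by linarith
    then show "norm L \<le> 1" by (intro LIMSEQ_le_const2[OF tendsto_norm[OF L]]) blast
    have "(\<lambda>n. 2 *\<^sub>R Y (Suc n)) \<longlonglongrightarrow> 2 *\<^sub>R L"
      by (intro tendsto_intros LIMSEQ_Suc L)
    moreover have "(\<lambda>n. 2 *\<^sub>R Y (Suc n)) \<longlonglongrightarrow> X + (L o\<^sub>L L)"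
      unfolding Y(2) by (simp, intro tendsto_intros comp.tendsto L)
    ultimately show "2 *\<^sub>R L = X + (L o\<^sub>L L)" by (rule LIMSEQ_unique)
  next
    fix D assume D: "D o\<^sub>L X = X o\<^sub>L D"
    have "(\<lambda>n. D o\<^sub>L Y n) \<longlonglongrightarrow> (D o\<^sub>L L)" "(\<lambda>n. Y n o\<^sub>L D) \<longlonglongrightarrow> (L o\<^sub>L D)"
      by (intro comp.tendsto L tendsto_const)+
    then show "D o\<^sub>L L = L o\<^sub>L D" unfolding comm[OF D] by (rule LIMSEQ_unique)
  qed
qed


section \<open>Absolute value, coercive operators and the spectral cut-off\<close>

context real_hilbert_form
begin

text \<open>With \<open>k\<close> a bound for \<open>C\<close>, the operator
  \<open>X = 1 - C\<^sup>2 / k\<^sup>2\<close> is a contraction. The iteration yields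
  \<open>Y\<close> with \<open>(1 - Y)\<^sup>2 = 1 - X\<close>, so \<open>R = k (1 - Y)\<close>
  squares to \<open>C\<^sup>2\<close>, and \<open>norm Y \<le> 1\<close> makes it positive. What
  commutes with \<open>C\<close> commutes with \<open>X\<close>, hence with
  \<open>Y\<close>.\<close>

lemma absolute_value:
  assumes C: "bounded_linear C" and sym: "\<And>x y. B (C x) y = B x (C y)"
  obtains R where "bounded_linear R" "\<And>v. R (R v) = C (C v)" "\<And>v. 0 \<le> B (R v) v"
    "\<And>D v. bounded_linear D \<Longrightarrow> (\<And>v. D (C v) = C (D v)) \<Longrightarrow> D (R v) = R (D v)"
proof -
  interpret C: bounded_linear C by (rule C)
  obtain k where k: "k > 0" "\<And>x. norm (C x) \<le> norm x * k" using C.pos_bounded by blast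
  define X where "X = Blinfun (\<lambda>v. v - (1 / k\<^sup>2) *\<^sub>R C (C v))"
  have "bounded_linear (\<lambda>v. v - (1 / k\<^sup>2) *\<^sub>R C (C v))"
    by (intro bounded_linear_intros C C.bounded_linear bounded_linear_compose[OF C])
  then have X: "blinfun_apply X v = v - (1 / k\<^sup>2) *\<^sub>R C (C v)" for v
    unfolding X_def by (simp add: bounded_linear_Blinfun_apply)
  have "norm (X v) \<le> norm v" for v
  proof -
    have "norm (C (C v)) \<le> k * norm (C v)" using k(2)[of "C v"] by (simp add: mult.commute)
    then have "(norm (C (C v)))\<^sup>2 \<le> k\<^sup>2 * (norm (C v))\<^sup>2"
      by (metis norm_ge_zero power_mono power_mult_distrib)
    then have le: "(norm (C (C v)))\<^sup>2 / k\<^sup>2 \<le> (norm (C v))\<^sup>2"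
      using k(1) by (simp add: field_simps)
    \<comment> \<open>Symmetry of \<open>C\<close> turns the cross term \<open>B v (C (C v))\<close>
      into \<open>(norm (C v))\<^sup>2\<close>.\<close>
    have "(norm (X v))\<^sup>2
        = (norm v)\<^sup>2 - (2 / k\<^sup>2) * (norm (C v))\<^sup>2 + (1 / k\<^sup>2) * ((norm (C (C v)))\<^sup>2 / k\<^sup>2)"
      using sym[of v "C v"] by (simp add: X norm_diff_scaleR_square form_self power_divide)
    also have "\<dots> \<le> (norm v)\<^sup>2 - (2 / k\<^sup>2) * (norm (C v))\<^sup>2 + (1 / k\<^sup>2) * (norm (C v))\<^sup>2"
      using le by (intro add_left_mono mult_left_mono) auto
    also have "\<dots> \<le> (norm v)\<^sup>2" by (simp add: algebra_simps)
    finally show ?thesis using norm_ge_zero power2_le_imp_le by blast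
  qed
  then have "norm X \<le> 1" by (intro norm_blinfun_bound) auto
  then obtain Y where Y: "norm Y \<le> 1" "2 *\<^sub>R Y = X + (Y o\<^sub>L Y)"
    "\<And>D. D o\<^sub>L X = X o\<^sub>L D \<Longrightarrow> D o\<^sub>L Y = Y o\<^sub>L D"
    by (rule half_square_iteration) blast
  define R where "R = (\<lambda>v. k *\<^sub>R (v - Y v))"
  show thesis
  proof
    show "bounded_linear R" unfolding R_def
      by (intro bounded_linear_intros blinfun.bounded_linear_right)
    show "R (R v) = C (C v)" for v
    proof -
      have "2 *\<^sub>R Y v = X v + Y (Y v)"
        by (metis Y(2) blinfun.add_left blinfun.scaleR_left blinfun_apply_blinfun_compose)
      then have Y2: "Y (Y v) = 2 *\<^sub>R Y v - X v" by simp
      have "v - Y v - Y (v - Y v) = v - X v"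
        by (simp add: blinfun.diff_right Y2 scaleR_2)
      then have "R (R v) = (k * k) *\<^sub>R (v - X v)"
        by (simp add: R_def blinfun.scaleR_right scaleR_diff_right[symmetric])
      then show ?thesis using k(1) by (simp add: X power2_eq_square)
    qed
    show "0 \<le> B (R v) v" for v
    proof -
      have "B (Y v) v \<le> norm (Y v) * norm v" by (rule form_le_norm)
      also have "\<dots> \<le> norm v * norm v"
        using norm_blinfun[of Y v] Y(1) mult_right_mono[of "norm Y" 1 "norm v"]
        by (intro mult_right_mono) auto
      finally show ?thesis
        using k(1) by (simp add: R_def scaleR_left diff_left form_self power2_eq_square)
    qed
    show "D (R v) = R (D v)" if D: "bounded_linear D" and DC: "\<And>v. D (C v) = C (D v)" for D v
    proof -
      interpret D: bounded_linear D by (rule D)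
      have "Blinfun D o\<^sub>L X = X o\<^sub>L Blinfun D"
        by (rule blinfun_eqI)
          (simp add: bounded_linear_Blinfun_apply[OF D] X D.diff D.scaleR DC)
      then have "Blinfun D o\<^sub>L Y = Y o\<^sub>L Blinfun D" by (rule Y(3))
      then have "D (Y v) = Y (D v)"
        by (auto dest!: arg_cong[where f = "\<lambda>Z. blinfun_apply Z v"]
            simp: bounded_linear_Blinfun_apply[OF D])
      then show ?thesis by (simp add: R_def D.diff D.scaleR)
    qed
  qed
qed

text \<open>Lax-Milgram by Banach's fixed point theorem: for small \<open>\<tau>\<close> the map
  \<open>v - \<tau> (M v - s)\<close> is a contraction, and its fixed point solves the
  equation.\<close>

lemma coercive_surj:
  assumes M: "bounded_linear M" and e: "0 < e" "\<And>v. e * (norm v)\<^sup>2 \<le> B (M v) v"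
  shows "\<exists>v. M v = s"
proof -
  interpret M: bounded_linear M by (rule M)
  obtain k0 where k0: "\<And>x. norm (M x) \<le> norm x * k0" using M.bounded by blast
  \<comment> \<open>The maximum ensures \<open>0 < e / k \<le> 1\<close>, so the square root
    defining \<open>c\<close> has a radicand in \<open>[0, 1)\<close>.\<close>
  define k where "k = max k0 e"
  have k: "0 < k" "e \<le> k" using e by (auto simp: k_def)
  have kM: "norm (M x) \<le> norm x * k" for x
    using k0[of x] mult_left_mono[of k0 k "norm x"] by (simp add: k_def)
  \<comment> \<open>This \<open>\<tau>\<close> minimises
    \<open>1 - 2 \<tau> e + \<tau>\<^sup>2 k\<^sup>2\<close>; the minimum is
    \<open>c\<^sup>2\<close>.\<close>
  define \<tau> where "\<tau> = e / k\<^sup>2"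
  define c where "c = sqrt (1 - (e / k)\<^sup>2)"
  have ek: "0 < e / k" "e / k \<le> 1" using e k by auto
  then have sq: "0 < (e / k)\<^sup>2" "(e / k)\<^sup>2 \<le> 1"
    by (auto simp only: zero_less_power power_le_one less_imp_le)
  then have c: "0 \<le> c" "c < 1" "c\<^sup>2 = 1 - (e / k)\<^sup>2" unfolding c_def by auto
  have contr: "norm (v - \<tau> *\<^sub>R M v) \<le> c * norm v" for v
  proof -
    have "(norm (v - \<tau> *\<^sub>R M v))\<^sup>2 = (norm v)\<^sup>2 - 2 * \<tau> * B (M v) v + \<tau>\<^sup>2 * (norm (M v))\<^sup>2"
      by (simp add: norm_diff_scaleR_square form_commute)
    also have "\<dots> \<le> (norm v)\<^sup>2 - 2 * \<tau> * (e * (norm v)\<^sup>2) + \<tau>\<^sup>2 * (norm v * k)\<^sup>2"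
      using e(2)[of v] kM[of v] e(1) k(1)
      by (intro add_mono diff_left_mono mult_left_mono power_mono) (auto simp: \<tau>_def)
    also have "\<dots> = (c * norm v)\<^sup>2"
    proof -
      have "\<tau> * e = (e / k)\<^sup>2" "\<tau>\<^sup>2 * k\<^sup>2 = (e / k)\<^sup>2"
        using k(1) by (simp_all add: \<tau>_def power2_eq_square)
      then show ?thesis
        unfolding power_mult_distrib c(3) by algebra
    qed
    finally show ?thesis using c(1) by (meson mult_nonneg_nonneg norm_ge_zero power2_le_imp_le)
  qed
  have "dist (x - \<tau> *\<^sub>R (M x - s)) (y - \<tau> *\<^sub>R (M y - s)) \<le> c * dist x y" for x y
    using contr[of "x - y"] by (simp add: dist_norm M.diff algebra_simps)
  then have "\<exists>!v. v - \<tau> *\<^sub>R (M v - s) = v"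
    using c by (intro banach_fix_type) auto
  then obtain v where "v - \<tau> *\<^sub>R (M v - s) = v" by blast
  moreover have "\<tau> \<noteq> 0" using e k by (simp add: \<tau>_def)
  ultimately show ?thesis by auto
qed

text \<open>\<open>P\<close>, twice the positive part of \<open>M - e\<close>, replaces a spectral
  projection: \<open>P M\<close> is non-zero and has the same range as \<open>P\<close>, so
  \<open>P (M v + s) = 0\<close> is solvable for every \<open>s\<close> even if \<open>M\<close> is
  not surjective.\<close>

lemma spectral_cutoff:
  assumes M: "bounded_linear M" and sym: "\<And>x y. B (M x) y = B x (M y)" and w: "0 < B (M w) w"
  obtains P where "bounded_linear P" "\<exists>v. P (M v) \<noteq> 0" "\<And>s. \<exists>v. P (M v) = P s"
    "\<And>D v. bounded_linear D \<Longrightarrow> (\<And>v. D (M v) = M (D v)) \<Longrightarrow> D (P v) = P (D v)"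
proof -
  interpret M: bounded_linear M by (rule M)
  have w0: "0 < norm w" using w by (auto simp: zero_right)
  \<comment> \<open>Half the Rayleigh quotient of \<open>w\<close>, so that \<open>B (C w) w\<close>
    stays positive.\<close>
  define e where "e = B (M w) w / (2 * (norm w)\<^sup>2)"
  have e: "0 < e" "e * (norm w)\<^sup>2 < B (M w) w" using w w0 by (auto simp: e_def field_simps)
  define C where "C = (\<lambda>v. M v - e *\<^sub>R v)"
  have C: "bounded_linear C" unfolding C_def by (intro bounded_linear_intros M)
  interpret C: bounded_linear C by (rule C)
  have "B (C x) y = B x (C y)" for x y
    by (simp add: C_def diff_left diff_right scaleR_left scaleR_right sym)
  from absolute_value[OF C this] obtain R where R: "bounded_linear R" "\<And>v. R (R v) = C (C v)"
    "\<And>v. 0 \<le> B (R v) v"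
    "\<And>D v. bounded_linear D \<Longrightarrow> (\<And>v. D (C v) = C (D v)) \<Longrightarrow> D (R v) = R (D v)"
    by blast
  interpret R: bounded_linear R by (rule R)
  define P where "P = (\<lambda>v. R v + C v)"
  have P: "bounded_linear P" unfolding P_def by (intro bounded_linear_intros C R)
  interpret P: bounded_linear P by (rule P)
  have CR: "C (R v) = R (C v)" for v by (rule R(4)[OF C refl])
  \<comment> \<open>All three are \<open>C\<^sup>2 + R C\<close>, since
    \<open>R\<^sup>2 = C\<^sup>2\<close> and \<open>R\<close>, \<open>C\<close> commute.\<close>
  have PR: "P (R v) = P (C v)" and RP: "R (P v) = P (C v)" for v
    by (simp_all add: P_def R.add R(2) CR add.commute)
  have PM: "P (M v) = P (e *\<^sub>R v + R v)" for v
    using PR[of v] by (simp add: C_def P.diff P.add algebra_simps)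
  show thesis
  proof
    show "bounded_linear P" by (rule P)
    show "\<exists>v. P (M v) \<noteq> 0"
    proof (rule ccontr)
      assume "\<nexists>v. P (M v) \<noteq> 0"
      \<comment> \<open>If \<open>P M = 0\<close>, then \<open>R P = P C = - e P\<close>, so
        positivity of \<open>R\<close> forces \<open>P = 0\<close>. Then \<open>R = - C\<close>, and
        positivity of \<open>R\<close> contradicts the choice of \<open>e\<close>.\<close>
      then have "P (C v) = - (e *\<^sub>R P v)" for v by (simp add: C_def P.diff P.scaleR)
      then have "e * (norm (P v))\<^sup>2 \<le> 0" for v
        using R(3)[of "P v"] by (simp add: RP minus_left scaleR_left form_self)
      then have "P w = 0" using e(1) by (simp add: mult_le_0_iff)
      then have "R w = - C w" by (simp add: P_def eq_neg_iff_add_eq_0)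
      then show False
        using R(3)[of w] e(2) by (simp add: C_def minus_left diff_left scaleR_left form_self)
    qed
    show "\<exists>v. P (M v) = P s" for s
    proof -
      have "\<exists>v. e *\<^sub>R v + R v = s"
      proof (rule coercive_surj[OF _ e(1)])
        show "bounded_linear (\<lambda>v. e *\<^sub>R v + R v)" by (intro bounded_linear_intros R)
        show "e * (norm v)\<^sup>2 \<le> B (e *\<^sub>R v + R v) v" for v
          using R(3)[of v] by (simp add: add_left scaleR_left form_self)
      qed
      then show ?thesis using PM by metis
    qed
    show "D (P v) = P (D v)" if D: "bounded_linear D" and DM: "\<And>v. D (M v) = M (D v)" for D v
    proof -
      interpret D: bounded_linear D by (rule D)
      have DC: "D (C v) = C (D v)" for v by (simp add: C_def D.diff D.scaleR DM)
      show ?thesis using R(4)[of D v, OF D DC] by (simp add: P_def D.add DC)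
    qed
  qed
qed

end

section \<open>Conjugation and the underlying real Hilbert space\<close>

lemma conjugate_cases:
  fixes z :: "'k::real_or_complex"
  obtains a b where "z = a *\<^sub>R 1 + b *\<^sub>R imunit" "conjugate z = a *\<^sub>R 1 - b *\<^sub>R imunit"
  using scalar_decomp conjugate_decomp by metis

lemma conjugate_mult:
  "conjugate (x * y) = conjugate x * conjugate (y :: 'k::real_or_complex)"
proof -
  obtain a b where x: "x = a *\<^sub>R 1 + b *\<^sub>R imunit" "conjugate x = a *\<^sub>R 1 - b *\<^sub>R imunit"
    by (rule conjugate_cases)
  obtain c d where y: "y = c *\<^sub>R 1 + d *\<^sub>R imunit" "conjugate y = c *\<^sub>R 1 - d *\<^sub>R imunit"
    by (rule conjugate_cases)
  \<comment> \<open>The real number \<open>r\<close> is 0 or -1; keeping it symbolic treats both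
    scalar fields at once.\<close>
  obtain r where r: "(imunit :: 'k) * imunit = r *\<^sub>R 1"
    using imunit_cases by (metis mult_zero_left scaleR_zero_left scaleR_minus1_left)
  have xy: "x * y = (a * c + b * d * r) *\<^sub>R 1 + (a * d + b * c) *\<^sub>R imunit"
    unfolding x y by (simp add: algebra_simps r)
  show ?thesis
    unfolding xy conjugate_decomp x(2) y(2) by (simp add: algebra_simps r)
qed

lemma conjugate_conjugate: "conjugate (conjugate x) = (x :: 'k::real_or_complex)"
proof -
  obtain a b where x: "x = a *\<^sub>R 1 + b *\<^sub>R imunit" "conjugate x = a *\<^sub>R 1 - b *\<^sub>R imunit"
    by (rule conjugate_cases)
  then show ?thesis using conjugate_decomp[of a "- b", where ?'a = 'k] by simp
qed

lemma conjugate_of_real: "conjugate (of_real r) = (of_real r :: 'k::real_or_complex)"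
  using conjugate_decomp[of r 0, where ?'a = 'k] by (simp add: of_real_def)

text \<open>Polarization: in a Hilbert space this is the real part of \<open>ip\<close>. Written
  with the norm, it requires no real part function on the scalars.\<close>

definition real_form :: "'h::real_normed_vector \<Rightarrow> 'h \<Rightarrow> real"
  where "real_form x y = ((norm (x + y))\<^sup>2 - (norm x)\<^sup>2 - (norm y)\<^sup>2) / 2"

context hilbert_space
begin

lemma ip_add_right: "ip x (y + z) = ip x y + ip x z"
proof -
  have "conjugate (u + v) = conjugate u + conjugate v" for u v :: 'k
  proof -
    obtain a b where u: "u = a *\<^sub>R 1 + b *\<^sub>R imunit" "conjugate u = a *\<^sub>R 1 - b *\<^sub>R imunit"
      by (rule conjugate_cases)
    obtain c d where v: "v = c *\<^sub>R 1 + d *\<^sub>R imunit" "conjugate v = c *\<^sub>R 1 - d *\<^sub>R imunit"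
      by (rule conjugate_cases)
    have uv: "u + v = (a + c) *\<^sub>R 1 + (b + d) *\<^sub>R imunit" unfolding u v by (simp add: algebra_simps)
    show ?thesis unfolding uv conjugate_decomp u(2) v(2) by (simp add: algebra_simps)
  qed
  then show ?thesis by (metis ip_add_left ip_conjugate)
qed

lemma ip_smul_right: "ip x (smul c y) = conjugate c * ip x y"
  by (metis conjugate_mult ip_conjugate ip_smul_left)

text \<open>Expand \<open>ip (x + y) (x + y)\<close>. Since \<open>of_real\<close> is injective,
  identities for \<open>real_form\<close> can thus be checked among scalars.\<close>

lemma of_real_real_form: "of_real (2 * real_form x y) = ip x y + ip y x"
proof -
  have "of_real (2 * real_form x y) = ip (x + y) (x + y) - ip x x - ip y y"
    by (simp add: real_form_def ip_self)
  then show ?thesis by (simp add: ip_add_left ip_add_right algebra_simps)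
qed

lemma real_form_eqI:
  assumes "ip x y + ip y x = ip x' y' + ip y' x'"
  shows "real_form x y = real_form x' y'"
  using assms of_real_real_form[of x y] of_real_real_form[of x' y']
  by (metis mult_cancel_left of_real_eq_iff zero_neq_numeral)

lemma real_hilbert_form_real_form: "real_hilbert_form (real_form :: 'h \<Rightarrow> 'h \<Rightarrow> real)"
proof
  fix x y z :: 'h and r :: real
  have "(of_real (2 * real_form (x + y) z) :: 'k)
      = of_real (2 * (real_form x z + real_form y z))"
    unfolding distrib_left of_real_add of_real_real_form
    by (simp add: ip_add_left ip_add_right algebra_simps)
  then show "real_form (x + y) z = real_form x z + real_form y z"
    by (metis mult_cancel_left of_real_eq_iff zero_neq_numeral)
  have "ip (r *\<^sub>R x) y + ip y (r *\<^sub>R x) = of_real r * (ip x y + ip y x)"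
    by (simp add: smul_of_real[symmetric] ip_smul_left ip_smul_right conjugate_of_real
        algebra_simps)
  then have "(of_real (2 * real_form (r *\<^sub>R x) y) :: 'k) = of_real (r * (2 * real_form x y))"
    by (simp only: of_real_real_form of_real_mult[of r])
  then show "real_form (r *\<^sub>R x) y = r * real_form x y"
    unfolding of_real_eq_iff by simp
  show "real_form x y = real_form y x" by (simp add: real_form_def add.commute)
  show "real_form x x = (norm x)\<^sup>2"
    by (simp add: real_form_def scaleR_2[symmetric] power_mult_distrib)
qed

text \<open>The adjoint of a scalar multiplication is again one; this is how linearity over
  \<open>'k\<close> is recovered for operators constructed from the real form.\<close>

lemma real_form_smul: "real_form (smul c x) y = real_form x (smul (conjugate c) y)"
  by (rule real_form_eqI) (simp add: ip_smul_left ip_smul_right conjugate_conjugate)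

lemma linear_smul_commute:
  assumes "Vector_Spaces.linear smul smul T"
  shows "T (smul c x) = smul c (T x)"
  using assms by (metis module_hom.scale Vector_Spaces.linear_iff_module_hom)

lemma linear_scaleR_commute:
  assumes "Vector_Spaces.linear smul smul T"
  shows "T (r *\<^sub>R x) = r *\<^sub>R T x"
  by (metis linear_smul_commute assms smul_of_real)

lemma bounded_linear_smul: "bounded_linear (smul c)"
proof (rule bounded_linear_intro)
  show "smul c (x + y) = smul c x + smul c y" for x y by (rule scale_right_distrib)
  show "smul c (r *\<^sub>R x) = r *\<^sub>R smul c x" for r x
    by (simp add: smul_of_real[symmetric] mult.commute)
  \<comment> \<open>The constant comes from
    \<open>ip (smul c x) (smul c x) = c * conjugate c * ip x x\<close>; it avoids comparing the
    norms of \<open>c\<close> and \<open>conjugate c\<close>.\<close>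
  show "norm (smul c x) \<le> norm x * sqrt (norm c * norm (conjugate c))" for x
  proof -
    have "of_real ((norm (smul c x))\<^sup>2) = c * (conjugate c * of_real ((norm x)\<^sup>2))"
      by (simp only: ip_self[symmetric] ip_smul_left ip_smul_right mult.left_commute)
    then have "norm (of_real ((norm (smul c x))\<^sup>2) :: 'k)
        = norm (c * (conjugate c * of_real ((norm x)\<^sup>2)))" by simp
    then have "(norm (smul c x))\<^sup>2 = (norm x)\<^sup>2 * (norm c * norm (conjugate c))"
      by (simp add: norm_mult norm_power)
    then have "norm (smul c x) = sqrt ((norm x)\<^sup>2 * (norm c * norm (conjugate c)))"
      by (metis norm_ge_zero real_sqrt_unique)
    then show ?thesis by (simp add: real_sqrt_mult)
  qed
qed

end


section \<open>Affine actions: commutant and invariant subspaces\<close>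

context affine_isometric_action
begin

interpretation form: real_hilbert_form "real_form :: 'h \<Rightarrow> 'h \<Rightarrow> real"
  by (rule real_hilbert_form_real_form)

lemma rep_linear: "Vector_Spaces.linear smul smul (\<pi> g)"
  using unitary[of g] by (simp add: unitary_operator_def)

lemma rep_bounded_linear: "bounded_linear (\<pi> g)"
proof (rule bounded_linear_intro)
  show "\<pi> g (x + y) = \<pi> g x + \<pi> g y" for x y
    using rep_linear[of g] by (metis module_hom.add Vector_Spaces.linear_iff_module_hom)
  show "\<pi> g (r *\<^sub>R x) = r *\<^sub>R \<pi> g x" for r x by (rule linear_scaleR_commute[OF rep_linear])
  show "norm (\<pi> g x) \<le> norm x * 1" for x
  proof -
    have "ip (\<pi> g x) (\<pi> g x) = ip x x" using unitary[of g] by (simp add: unitary_operator_def)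
    then have "(norm (\<pi> g x))\<^sup>2 = (norm x)\<^sup>2" unfolding ip_self of_real_eq_iff .
    then show ?thesis by simp
  qed
qed

interpretation rep: bounded_linear "\<pi> g" for g
  by (rule rep_bounded_linear)

lemma rep_inverse: "\<pi> g (\<pi> (- g) x) = x"
  using rep_add[of g "- g"] rep_zero by (metis add.right_inverse comp_apply id_apply)

lemma real_form_rep: "real_form (\<pi> g x) y = real_form x (\<pi> (- g) y)"
proof -
  have "ip (\<pi> g u) (\<pi> g v) = ip u v" for u v
    using unitary[of g] by (simp add: unitary_operator_def)
  then have "real_form (\<pi> g x) (\<pi> g (\<pi> (- g) y)) = real_form x (\<pi> (- g) y)"
    by (intro real_form_eqI) simp
  then show ?thesis by (simp add: rep_inverse)
qed

text \<open>The cocycle cancels from the commutation relation, leaving \<open>\<pi> g t = t\<close>.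
  This links properties (ii) and (iii).\<close>

lemma translation_in_commutant_iff:
  "translation t \<in> commutant smul \<alpha> \<longleftrightarrow> t \<in> fixed_vectors \<pi>"
proof -
  have "continuous_affine_map smul (translation t)"
    unfolding continuous_affine_map_def translation_def
    by (rule exI[of _ "\<lambda>v. v"], rule exI[of _ t]) (simp add: linear_ident bounded_linear_ident)
  moreover have "translation t \<circ> \<alpha> g = \<alpha> g \<circ> translation t \<longleftrightarrow> \<pi> g t = t" for g
    by (auto simp: fun_eq_iff translation_def action_eq rep.add)
  ultimately show ?thesis by (simp add: commutant_def fixed_vectors_def)
qed

lemma irreducible_imp_translation:
  assumes irr: "irreducible_action smul \<alpha>" and A: "A \<in> commutant smul \<alpha>"
  shows "A \<in> range translation"
proof -
  obtain T t where T: "Vector_Spaces.linear smul smul T" "bounded_linear T"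
    and A_eq: "A = (\<lambda>v. T v + t)"
    using A by (auto simp: commutant_def continuous_affine_map_def)
  interpret T: bounded_linear T by (rule T)
  have comm: "T (\<pi> g v) + T (b g) + t = \<pi> g (T v) + \<pi> g t + b g" for g v
  proof -
    have "A (\<alpha> g v) = \<alpha> g (A v)" using A by (simp add: commutant_def fun_eq_iff)
    then show ?thesis
      by (simp add: A_eq action_eq T.add rep.add)
  qed
  \<comment> \<open>The value at 0 isolates the constant terms; subtracting them leaves the linear
    parts.\<close>
  have Tb: "T (b g) + t = \<pi> g t + b g" for g
    using comm[of g 0] by (simp add: T.zero rep.zero)
  have T\<pi>: "T (\<pi> g v) = \<pi> g (T v)" for g v
    using comm[of g v] Tb[of g] by (simp add: add.assoc)
  define N where "N = (\<lambda>v. T v - v)"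
  have N: "bounded_linear N" unfolding N_def by (intro bounded_linear_intros T)
  have N\<pi>: "N (\<pi> g v) = \<pi> g (N v)" for g v
    by (simp add: N_def T\<pi> rep.diff)
  have Nsmul: "N (smul c v) = smul c (N v)" for c v
    by (simp add: N_def linear_smul_commute[OF T(1)] scale_right_diff_distrib)
  have Nb: "N (b g) = \<pi> g t - t" for g using Tb[of g] by (simp add: N_def algebra_simps)
  \<comment> \<open>The adjoint of \<open>N\<close> serves to form the symmetric positive operator
    \<open>N' N\<close>, to which the cut-off applies.\<close>
  obtain N' where N': "bounded_linear N'" "\<And>v y. real_form (N' v) y = real_form v (N y)"
    using form.compressed_adjoint[OF real_vector.subspace_UNIV closed_UNIV N] by auto
  interpret N': bounded_linear N' by (rule N'(1))
  have N'\<pi>: "N' (\<pi> g v) = \<pi> g (N' v)" for g v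
    by (rule form.compressed_adjoint_commute[OF real_vector.subspace_UNIV, where T = N and D' = "\<pi> (- g)"])
      (auto simp: N' real_form_rep N\<pi>)
  have N'smul: "N' (smul c v) = smul c (N' v)" for c v
    by (rule form.compressed_adjoint_commute[OF real_vector.subspace_UNIV, where T = N and D' = "smul (conjugate c)"])
      (auto simp: N' real_form_smul Nsmul)
  define M where "M = (\<lambda>v. N' (N v))"
  define s where "s = N' t"
  have M: "bounded_linear M" unfolding M_def by (rule bounded_linear_compose[OF N'(1) N])
  interpret M: bounded_linear M by (rule M)
  have M_form: "real_form (M x) y = real_form (N x) (N y)" for x y by (simp add: M_def N')
  have M_sym: "real_form (M x) y = real_form x (M y)" for x y
    by (metis M_form form.form_commute)
  have M\<pi>: "\<pi> g (M v) = M (\<pi> g v)" and Msmul: "smul c (M v) = M (smul c v)" for g c v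
    by (simp_all add: M_def N\<pi> Nsmul N'\<pi> N'smul)
  \<comment> \<open>Here \<open>M v + s = N' (A v - v)\<close>; the difference of two points moves
    by the linear part \<open>\<pi> g\<close>, which commutes with \<open>N'\<close>.\<close>
  have equivariant: "M (\<alpha> g v) + s = \<pi> g (M v + s)" for g v
  proof -
    have "M (b g) + s = \<pi> g s" by (simp add: M_def s_def Nb N'.diff N'\<pi>)
    then show ?thesis
      by (simp add: action_eq M.add rep.add M\<pi> add.assoc)
  qed
  have "N w = 0" for w
  proof (rule ccontr)
    assume "N w \<noteq> 0"
    then have "0 < real_form (M w) w" by (simp add: M_form form.form_self)
    from form.spectral_cutoff[OF M M_sym this]
    obtain P where P: "bounded_linear P" "\<exists>v. P (M v) \<noteq> 0" "\<And>s. \<exists>v. P (M v) = P s"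
      and P_comm: "\<And>D v. bounded_linear D \<Longrightarrow> (\<And>v. D (M v) = M (D v)) \<Longrightarrow> D (P v) = P (D v)"
      by blast
    interpret P: bounded_linear P by (rule P)
    have P\<pi>: "\<pi> g (P v) = P (\<pi> g v)" for g v by (rule P_comm[OF rep_bounded_linear M\<pi>])
    have Psmul: "smul c (P v) = P (smul c v)" for c v
      by (rule P_comm[OF bounded_linear_smul Msmul])
    define S where "S = {v. P (M v + s) = 0}"
    have "affine_subspace smul S"
      unfolding affine_subspace_def
    proof (intro ballI allI impI)
      fix x y u v assume xy: "x \<in> S" "y \<in> S" and uv: "u + v = (1 :: 'k)"
      \<comment> \<open>As \<open>u + v = 1\<close>, the constant splits along the affine
        combination.\<close>
      have "s = smul u s + smul v s" by (metis scale_left_distrib scale_one uv)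
      then have "M (smul u x + smul v y) + s = smul u (M x + s) + smul v (M y + s)"
        by (simp add: M.add Msmul scale_right_distrib algebra_simps)
      then have "P (M (smul u x + smul v y) + s)
          = smul u (P (M x + s)) + smul v (P (M y + s))"
        by (simp only: P.add[of "smul u (M x + s)"] Psmul)
      then show "smul u x + smul v y \<in> S" using xy by (simp add: S_def)
    qed
    moreover have "S \<noteq> {}"
    proof -
      obtain v where "P (M v) = P (0 - s)" using P(3) by blast
      then have "v \<in> S" by (simp add: S_def P.add P.diff P.zero del: diff_0)
      then show ?thesis by blast
    qed
    moreover have "closed S"
      unfolding S_def
      by (intro closed_Collect_eq continuous_intros P.continuous_on M.continuous_on)
    moreover have "S \<noteq> UNIV"
    proof
      assume "S = UNIV"
      then have S: "P (M v + s) = 0" for v by (auto simp: S_def)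
      \<comment> \<open>The point 0 gives \<open>P s = 0\<close>, hence \<open>P M = 0\<close>,
        which the cut-off excludes.\<close>
      have "P s = 0" using S[of 0] by (simp add: M.zero)
      then show False using S P(2) by (simp add: P.add)
    qed
    moreover have "\<alpha> g ` S \<subseteq> S" for g
      by (auto simp: S_def equivariant P\<pi>[symmetric] rep.zero)
    ultimately show False using irr unfolding irreducible_action_def by blast
  qed
  then have "T v = v" for v by (simp add: N_def)
  then show ?thesis by (auto simp: A_eq translation_def)
qed

text \<open>The projection onto an invariant \<open>S\<close> fixes points of \<open>S\<close>; if
  it is a translation, it is the identity and \<open>S\<close> is everything.\<close>

lemma translations_imp_irreducible:
  assumes trans: "commutant smul \<alpha> \<subseteq> range translation"
  shows "irreducible_action smul \<alpha>"
  unfolding irreducible_action_def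
proof
  assume "\<exists>S. affine_subspace smul S \<and> S \<noteq> {} \<and> closed S \<and> S \<noteq> UNIV \<and> (\<forall>g. \<alpha> g ` S \<subseteq> S)"
  then obtain S where S: "affine_subspace smul S" "S \<noteq> {}" "closed S" "S \<noteq> UNIV"
    "\<And>g. \<alpha> g ` S \<subseteq> S"
    by blast
  have aff: "smul u x + smul v y \<in> S" if "x \<in> S" "y \<in> S" "u + v = 1" for x y u v
    using S(1) that by (simp add: affine_subspace_def)
  have inv: "\<alpha> g x \<in> S" if "x \<in> S" for g x using S(5)[of g] that by auto
  obtain s0 where s0: "s0 \<in> S" using S(2) by blast
  \<comment> \<open>The direction space of \<open>S\<close>.\<close>
  define K where "K = {k. s0 + k \<in> S}"
  have K_smul: "smul c x \<in> K" if "x \<in> K" for c x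
    using aff[of "s0 + x" s0 c "1 - c"] that s0
    by (simp add: K_def scale_right_distrib scale_left_diff_distrib algebra_simps)
  have K_add: "x + y \<in> K" if "x \<in> K" "y \<in> K" for x y
  proof -
    \<comment> \<open>A sum is not an affine combination of the given points, so take the midpoint
      and double it by \<open>K_smul\<close>.\<close>
    have "smul (1/2) (s0 + x) + smul (1/2) (s0 + y) \<in> S"
      using that by (intro aff) (auto simp: K_def)
    moreover have "smul (1/2) s0 + smul (1/2) s0 = s0"
      by (simp add: scale_left_distrib[symmetric])
    ultimately have "s0 + smul (1/2) (x + y) \<in> S"
      by (metis (no_types, lifting) add.assoc add.left_commute scale_right_distrib)
    then have "smul 2 (smul (1/2) (x + y)) \<in> K" by - (rule K_smul, simp add: K_def)
    then show ?thesis by simp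
  qed
  have K: "Real_Vector_Spaces.subspace K"
    using K_add K_smul[of _ "of_real _"] s0
    by (intro real_vector.subspaceI) (auto simp: K_def smul_of_real)
  have "closed ((\<lambda>k. s0 + k) -` S)"
    by (intro closed_vimage S(3) continuous_intros)
  then have K_closed: "closed K" by (simp add: K_def vimage_def)
  have shift: "\<pi> g s0 + b g - s0 \<in> K" for g
    using inv[OF s0, of g] by (simp add: K_def action_eq)
  have K_rep: "\<pi> g x \<in> K" if "x \<in> K" for g x
  proof -
    have "\<alpha> g (s0 + x) - s0 \<in> K" using inv[of "s0 + x" g] that by (simp add: K_def)
    from real_vector.subspace_diff[OF K this shift[of g]] show ?thesis
      by (simp add: action_eq rep.add)
  qed
  obtain p where p: "bounded_linear p" "\<And>v. p v \<in> K"
    "\<And>v y. y \<in> K \<Longrightarrow> real_form (p v) y = real_form v y"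
    by (rule form.compressed_adjoint[OF K K_closed bounded_linear_ident]) blast
  interpret p: bounded_linear p by (rule p)
  have p_id: "p v = v" if "v \<in> K" for v
    by (rule form.form_eqI[OF K]) (simp_all add: p that)
  have p\<pi>: "p (\<pi> g v) = \<pi> g (p v)" for g v
    by (rule form.compressed_adjoint_commute[OF K, where T = "\<lambda>x. x" and D' = "\<pi> (- g)"])
      (auto simp: p real_form_rep K_rep)
  have p_smul: "p (smul c v) = smul c (p v)" for c v
    by (rule form.compressed_adjoint_commute[OF K, where T = "\<lambda>x. x" and D' = "smul (conjugate c)"])
      (auto simp: p real_form_smul K_smul)
  \<comment> \<open>That is \<open>A v = s0 + p (v - s0)\<close>, the orthogonal projection onto
    \<open>S\<close>.\<close>
  define A where "A = (\<lambda>v. p v + (s0 - p s0))"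
  have "Vector_Spaces.linear smul smul p"
    by unfold_locales (simp_all add: p.add p_smul)
  then have "continuous_affine_map smul A"
    unfolding continuous_affine_map_def A_def using p(1) by blast
  moreover have "A (\<alpha> g v) = \<alpha> g (A v)" for g v
  proof -
    \<comment> \<open>Equality of the constant terms: \<open>p\<close> fixes
      \<open>\<pi> g s0 + b g - s0\<close>, the displacement of \<open>s0\<close>, because it lies
      in \<open>K\<close>.\<close>
    have "p (b g) + (s0 - p s0) = \<pi> g (s0 - p s0) + b g"
      using p_id[OF shift[of g]]
      by (simp add: p.add p.diff p\<pi> rep.diff algebra_simps)
    then show ?thesis
      by (simp add: A_def action_eq p.add p\<pi> rep.add add.assoc)
  qed
  ultimately have "A \<in> commutant smul \<alpha>" by (simp add: commutant_def fun_eq_iff)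
  then obtain t where A_t: "A = translation t" using trans by blast
  have "A s0 = s0" by (simp add: A_def)
  then have "t = 0" by (simp add: A_t translation_def)
  then have A_id: "A v = v" for v by (simp add: A_t translation_def)
  have "v \<in> S" for v
  proof -
    have "s0 + p (v - s0) = A v" by (simp add: A_def p.diff)
    then show ?thesis using p(2)[of "v - s0"] by (simp add: K_def A_id)
  qed
  then show False using S(4) by blast
qed

end

theorem proposition3p4:
  fixes smul :: "'k::real_or_complex \<Rightarrow> 'h::banach \<Rightarrow> 'h"
    and ip :: "'h \<Rightarrow> 'h \<Rightarrow> 'k"
    and \<pi> :: "'g::topological_group_add \<Rightarrow> 'h \<Rightarrow> 'h"
    and b :: "'g \<Rightarrow> 'h"
    and \<alpha> :: "'g \<Rightarrow> 'h \<Rightarrow> 'h"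
  assumes "affine_isometric_action smul ip \<pi> b \<alpha>"
  shows "(irreducible_action smul \<alpha> \<longleftrightarrow> commutant smul \<alpha> = translation ` fixed_vectors \<pi>)
    \<and> (commutant smul \<alpha> = translation ` fixed_vectors \<pi> \<longleftrightarrow> commutant smul \<alpha> \<subseteq> range translation)"
proof -
  interpret affine_isometric_action smul ip \<pi> b \<alpha> by (rule assms)
  have "irreducible_action smul \<alpha> \<longleftrightarrow> commutant smul \<alpha> \<subseteq> range translation"
    using irreducible_imp_translation translations_imp_irreducible by blast
  moreover have "commutant smul \<alpha> = translation ` fixed_vectors \<pi>
      \<longleftrightarrow> commutant smul \<alpha> \<subseteq> range translation"
    using translation_in_commutant_iff by blast
  ultimately show ?thesis by blast
qed

end
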